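(* Let $p$ be a prime, $n$ a positive integer and $s$ a nonnegative integer. Let $\underline{a}=(a_0,a_1,\ldots)$ be an almost $p$-ary sequence of period $n+s$ with $s$ zero-symbols occupying $s$ consecutive positions. Let $\ell$ be the number of distinct elements in the set $\{C_{\underline{a}}(1),C_{\underline{a}}(2),\ldots,C_{\underline{a}}(n+s-1)\}$. Then $$\min\{s,p,n\}\le \ell\le n-1+\min\{n,s\}.$$
   Context: $\zeta_p\in\mathbb{C}$ is a fixed primitive $p$-th root of unity. An almost $p$-ary sequence of period $N$ with $s$ zero-symbols is a periodic complex sequence of period $N$ such that in one period exactly $s$ entries are $0$ and every other entry is of the form $\zeta_p^{b}$ for some integer $b$. The autocorrelation function of a sequence $\underline{a}$ of period $N$ is $C_{\underline{a}}(t)=\sum_{i=0}^{N-1}a_i\overline{a_{i+t}}$ (indices modulo $N$, bar denoting complex conjugation). *)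

theory Defs
  imports Complex_Main "HOL-Computational_Algebra.Primes"
begin

definition primitive_root_of_unity :: "nat \<Rightarrow> complex \<Rightarrow> bool" where
  "primitive_root_of_unity m z \<longleftrightarrow>
     m > 0 \<and> z ^ m = 1 \<and> (\<forall>k. 0 < k \<and> k < m \<longrightarrow> z ^ k \<noteq> 1)"

(* N is a period of a, not necessarily the least one.  The argument z stands for the fixed
   primitive p-th root of unity. *)
definition almost_pary :: "complex \<Rightarrow> nat \<Rightarrow> nat \<Rightarrow> (nat \<Rightarrow> complex) \<Rightarrow> bool" where
  "almost_pary z N s a \<longleftrightarrow>
     N > 0 \<and> (\<forall>i. a (i + N) = a i) \<and>
     card {i. i < N \<and> a i = 0} = s \<and>
     (\<forall>i<N. a i \<noteq> 0 \<longrightarrow> (\<exists>b::int. a i = z powi b))"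

definition autocorrelation :: "nat \<Rightarrow> (nat \<Rightarrow> complex) \<Rightarrow> nat \<Rightarrow> complex" where
  "autocorrelation N a t = (\<Sum>i<N. a i * cnj (a ((i + t) mod N)))"

(* A run of s zeros starting anywhere in the infinite sequence: within one period the run
   may wrap around.  A sequence with exactly s zeros per period, s < N, has no other zeros
   than the translates of such a run by multiples of N. *)
definition consecutive_zeros :: "nat \<Rightarrow> (nat \<Rightarrow> complex) \<Rightarrow> bool" where
  "consecutive_zeros s a \<longleftrightarrow> (\<exists>k. \<forall>j<s. a (k + j) = 0)"

end

theory Submission
  imports Defs
begin

text \<open>
  Rotate the sequence so that the zeros occupy the last \<open>s\<close> positions of the period. For
  \<open>t \<le> s\<close> the value \<open>C(t)\<close> is then a sum of exactly \<open>n - t\<close> (truncated) powers of \<open>\<zeta>\<close>. In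
  particular \<open>C(t) = 0\<close> for \<open>n \<le> t \<le> s\<close>, which gives the upper bound. For the lower bound, the
  Frobenius congruence shows that the \<open>p\<close>-th power of a sum of \<open>k\<close> powers of \<open>\<zeta>\<close> is congruent
  to \<open>k\<close> modulo \<open>p\<int>[\<zeta>]\<close>. Since \<open>\<int> \<inter> p\<int>[\<zeta>] = p\<int>\<close>, the sum determines \<open>k\<close> modulo \<open>p\<close>, so
  that \<open>C(1), \<dots>, C(m)\<close> are distinct for \<open>m = min {s, p, n}\<close>.
\<close>

section \<open>The ring generated by a root of unity\<close>

text \<open>Extend the map \<open>1\<close> to \<open>1\<close> from the independent set
  \<open>{1}\<close> to all of the rational vector space of complex numbers. It serves to bound
  denominators of rational elements of the span of the powers of \<open>z\<close>.\<close>

lemma exists_rat_linear_functional: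
  "\<exists>\<phi> :: complex \<Rightarrow> rat. (\<forall>q. \<phi> (of_rat q) = q) \<and> (\<forall>x y. \<phi> (x + y) = \<phi> x + \<phi> y) \<and>
     (\<forall>q x. \<phi> (of_rat q * x) = q * \<phi> x)"
proof -
  interpret vector_space_pair "\<lambda>(q::rat) (x::complex). of_rat q * x" "(*) :: rat \<Rightarrow> rat \<Rightarrow> rat"
    by unfold_locales (auto simp: algebra_simps of_rat_add of_rat_mult)
  have "vs1.independent {1}"
    by simp
  from linear_independent_extend[OF this, of "\<lambda>_. 1"] obtain \<phi>
    where lin: "Vector_Spaces.linear (\<lambda>(q::rat) (x::complex). of_rat q * x) (*) \<phi>" and one: "\<phi> 1 = 1"
    by auto
  have add: "\<phi> (x + y) = \<phi> x + \<phi> y" for x y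
    by (rule linear_add[OF lin])
  have scale: "\<phi> (of_rat q * x) = q * \<phi> x" for q x
    by (rule linear_scale[OF lin])
  from scale[of _ 1] one add scale show ?thesis
    by auto
qed

text \<open>This is \<open>\<int>[z]\<close> when \<open>z ^ m = 1\<close>.\<close>
definition int_span_powers :: "nat \<Rightarrow> complex \<Rightarrow> complex set" where
  "int_span_powers m z = range (\<lambda>c :: nat \<Rightarrow> int. \<Sum>i<m. of_int (c i) * z ^ i)"

lemma int_span_powers_add:
  assumes "x \<in> int_span_powers m z" "y \<in> int_span_powers m z"
  shows "x + y \<in> int_span_powers m z"
proof -
  from assms obtain c d where "x = (\<Sum>i<m. of_int (c i) * z ^ i)" "y = (\<Sum>i<m. of_int (d i) * z ^ i)"
    by (auto simp: int_span_powers_def)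
  then have "x + y = (\<Sum>i<m. of_int (c i + d i) * z ^ i)"
    by (simp add: sum.distrib algebra_simps)
  then show ?thesis
    unfolding int_span_powers_def by (rule range_eqI[of _ _ "\<lambda>i. c i + d i"])
qed

lemma int_span_powers_scale:
  assumes "x \<in> int_span_powers m z"
  shows "of_int k * x \<in> int_span_powers m z"
proof -
  from assms obtain c where "x = (\<Sum>i<m. of_int (c i) * z ^ i)"
    by (auto simp: int_span_powers_def)
  then have "of_int k * x = (\<Sum>i<m. of_int (k * c i) * z ^ i)"
    by (simp add: sum_distrib_left algebra_simps)
  then show ?thesis
    unfolding int_span_powers_def by (rule range_eqI[of _ _ "\<lambda>i. k * c i"])
qed

lemma int_span_powers_diff:
  assumes "x \<in> int_span_powers m z" "y \<in> int_span_powers m z"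
  shows "x - y \<in> int_span_powers m z"
  using int_span_powers_add[OF assms(1) int_span_powers_scale[OF assms(2), of "-1"]] by simp

lemma int_span_powers_zero: "0 \<in> int_span_powers m z"
  unfolding int_span_powers_def by (rule range_eqI[of _ _ "\<lambda>_. 0"]) simp

lemma int_span_powers_sum:
  assumes "\<And>i. i \<in> A \<Longrightarrow> f i \<in> int_span_powers m z"
  shows "sum f A \<in> int_span_powers m z"
  using assms
  by (induction A rule: infinite_finite_induct) (auto intro: int_span_powers_zero int_span_powers_add)

locale root_of_unity =
  fixes m :: nat and z :: complex
  assumes m_pos: "m > 0" and root: "z ^ m = 1"
begin

lemma power_mod: "z ^ k = z ^ (k mod m)"
proof -
  have "z ^ k = z ^ (m * (k div m) + k mod m)"
    by simp
  also have "\<dots> = z ^ (k mod m)"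
    by (simp only: power_add power_mult root power_one mult_1)
  finally show ?thesis .
qed

lemma power_mem: "z ^ k \<in> int_span_powers m z"
proof -
  have "z ^ (k mod m) = (\<Sum>i<m. of_int (of_bool (i = k mod m)) * z ^ i)"
    using m_pos by (simp add: of_bool_def if_distrib[of "\<lambda>c. c * _"] if_distrib[of of_int] sum.delta cong: if_cong)
  then show ?thesis
    unfolding int_span_powers_def power_mod[of k]
    by (rule range_eqI[of _ _ "\<lambda>i. of_bool (i = k mod m)"])
qed

text \<open>In a product the exponents \<open>i + j\<close> may reach \<open>m\<close> or more;
  \<open>z ^ m = 1\<close> folds them back through \<open>power_mem\<close>.\<close>

lemma mult_mem:
  assumes "x \<in> int_span_powers m z" "y \<in> int_span_powers m z"
  shows "x * y \<in> int_span_powers m z"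
proof -
  from assms obtain c d where "x = (\<Sum>i<m. of_int (c i) * z ^ i)" "y = (\<Sum>i<m. of_int (d i) * z ^ i)"
    by (auto simp: int_span_powers_def)
  then have "x * y = (\<Sum>i<m. \<Sum>j<m. of_int (c i * d j) * z ^ (i + j))"
    by (simp add: sum_product power_add algebra_simps)
  then show ?thesis
    by (simp only:) (intro int_span_powers_sum int_span_powers_scale power_mem)
qed

lemma one_mem: "1 \<in> int_span_powers m z"
  using power_mem[of 0] by simp

lemma pow_mem: "x \<in> int_span_powers m z \<Longrightarrow> x ^ k \<in> int_span_powers m z"
  by (induction k) (auto intro: one_mem mult_mem)

text \<open>Entries and their conjugates carry integer exponents, while the Frobenius argument works
  with natural ones.\<close>

lemma powi_eq_power: "\<exists>k. z powi b = z ^ k"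
proof -
  have "z \<noteq> 0"
    using root m_pos by (auto simp: power_0_left)
  have "z powi b = z powi (int m * (b div int m) + b mod int m)"
    by simp
  also have "\<dots> = (z powi int m) powi (b div int m) * z powi (b mod int m)"
    using \<open>z \<noteq> 0\<close> by (simp only: power_int_add power_int_mult simp_thms)
  also have "\<dots> = z ^ nat (b mod int m)"
    using root m_pos by (simp add: power_int_def)
  finally show ?thesis
    by blast
qed

lemma norm_root: "norm z = 1"
proof -
  have "norm z ^ m = 1 ^ m"
    by (simp add: norm_power[symmetric] root)
  then show ?thesis
    using m_pos by (simp only: power_eq_iff_eq_base norm_ge_zero zero_le_one)
qed

lemma cnj_powi: "cnj (z powi b) = z powi (- b)"
proof -
  have "z * cnj z = 1"
    by (simp add: complex_norm_square[symmetric] norm_root)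
  then have "cnj z = inverse z"
    by (metis inverse_unique)
  then show ?thesis
    by (simp add: power_int_minus power_int_inverse)
qed

text \<open>
  A \<open>\<rat>\<close>-linear functional that fixes \<open>\<rat>\<close> sends \<open>\<int>[z]\<close> into \<open>(1/D)\<int>\<close> for some \<open>D\<close>, whereas
  \<open>\<int>[z]\<close> contains every \<open>(k/p)^j\<close> if it contains \<open>k/p\<close>.
\<close>
lemma prime_dvd_of_mem:
  fixes p :: nat and k :: int
  assumes "prime p" and r: "r \<in> int_span_powers m z" and eq: "of_int k = of_nat p * r"
  shows "int p dvd k"
proof (rule ccontr)
  assume ndvd: "\<not> int p dvd k"
  obtain \<phi> :: "complex \<Rightarrow> rat" where \<phi>: "\<And>q. \<phi> (of_rat q) = q"
    "\<And>x y. \<phi> (x + y) = \<phi> x + \<phi> y" "\<And>q x. \<phi> (of_rat q * x) = q * \<phi> x"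
    using exists_rat_linear_functional by blast
  have \<phi>_int: "\<phi> (of_int c * x) = of_int c * \<phi> x" for c x
    using \<phi>(3)[of "of_int c" x] by simp
  have \<phi>_0: "\<phi> 0 = 0"
    using \<phi>(1)[of 0] by simp
  have \<phi>_sum: "\<phi> (sum f A) = (\<Sum>i\<in>A. \<phi> (f i))" for f and A :: "nat set"
    by (induction A rule: infinite_finite_induct) (auto simp: \<phi>_0 \<phi>(2))
  define den where "den i = snd (quotient_of (\<phi> (z ^ i)))" for i
  define D where "D = (\<Prod>i<m. den i)"
  have den_pos: "den i > 0" for i
    unfolding den_def by (rule quotient_of_denom_pos')
  have D_pos: "D > 0"
    unfolding D_def by (intro prod_pos) (simp add: den_pos)
  have den_int: "of_int (den i) * \<phi> (z ^ i) \<in> \<int>" for i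
  proof -
    obtain u v where uv: "quotient_of (\<phi> (z ^ i)) = (u, v)"
      by force
    then have "\<phi> (z ^ i) = of_int u / of_int v" "v > 0"
      by (auto simp: quotient_of_div quotient_of_denom_pos)
    moreover have "den i = v"
      by (simp add: den_def uv)
    ultimately show ?thesis
      by simp
  qed
  have D_int: "of_int D * \<phi> (z ^ i) \<in> \<int>" if "i < m" for i
  proof -
    have "D = den i * (\<Prod>j\<in>{..<m} - {i}. den j)"
      unfolding D_def using that by (subst prod.remove[of _ i]) auto
    then have "of_int D * \<phi> (z ^ i) = of_int (\<Prod>j\<in>{..<m} - {i}. den j) * (of_int (den i) * \<phi> (z ^ i))"
      by simp
    then show ?thesis
      by (metis Ints_mult Ints_of_int den_int)
  qed
  have p0: "p > 0"
    using \<open>prime p\<close> by (rule prime_gt_0_nat)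
  \<comment> \<open>One \<open>D\<close> serves all \<open>j\<close>: each \<open>r ^ j\<close> is
    again an integer combination of the same \<open>m\<close> powers, so \<open>D\<close> times its
    image under \<open>\<phi>\<close>, that is \<open>D * (k/p) ^ j\<close>, is an integer.\<close>
  have dvd: "int p ^ j dvd D" for j
  proof -
    obtain c where c: "r ^ j = (\<Sum>i<m. of_int (c i) * z ^ i)"
      using pow_mem[OF r, of j] by (auto simp: int_span_powers_def)
    have "of_rat ((of_int k / of_nat p) ^ j) = r ^ j"
      using eq p0 by (simp add: of_rat_power of_rat_divide)
    then have "(of_int k / of_nat p) ^ j = \<phi> (r ^ j)"
      by (metis \<phi>(1))
    also have "\<dots> = (\<Sum>i<m. of_int (c i) * \<phi> (z ^ i))"
      unfolding c \<phi>_sum \<phi>_int ..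
    finally have "of_int D * (of_int k / of_nat p) ^ j = (\<Sum>i<m. of_int (c i) * (of_int D * \<phi> (z ^ i)))"
      by (simp add: sum_distrib_left mult.left_commute)
    also have "\<dots> \<in> \<int>"
      by (intro Ints_sum Ints_mult Ints_of_int D_int) auto
    finally obtain w where "of_int D * (of_int k / of_nat p) ^ j = (of_int w :: rat)"
      by (auto elim: Ints_cases)
    then have "of_int (D * k ^ j) = (of_int (w * int p ^ j) :: rat)"
      using p0 by (simp add: field_simps)
    then have "D * k ^ j = w * int p ^ j"
      by (simp only: of_int_eq_iff)
    then have "int p ^ j dvd D * k ^ j"
      by simp
    moreover have "coprime (int p ^ j) (k ^ j)"
      using \<open>prime p\<close> ndvd by (simp add: prime_imp_coprime)
    ultimately show ?thesis
      by (simp add: coprime_dvd_mult_left_iff)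
  qed
  \<comment> \<open>Any exponent \<open>j\<close> with \<open>p ^ j > D\<close> contradicts
    \<open>D > 0\<close>; \<open>nat D\<close> is large enough.\<close>
  have "int p ^ nat D \<le> D"
    using dvd D_pos by (rule zdvd_imp_le)
  moreover have "nat D < p ^ nat D"
    using \<open>prime p\<close> by (intro power_gt_expt) (simp add: prime_ge_2_nat prime_gt_Suc_0_nat)
  then have "D < int p ^ nat D"
    using D_pos by (metis nat_less_iff of_nat_power order_less_imp_le)
  ultimately show False
    by simp
qed

text \<open>The inner binomial coefficients are divisible by \<open>p\<close>; \<open>r\<close>
  collects the quotients.\<close>

lemma frobenius_add:
  fixes p :: nat
  assumes "prime p" and x: "x \<in> int_span_powers m z" and y: "y \<in> int_span_powers m z"
  shows "\<exists>r\<in>int_span_powers m z. (x + y) ^ p = x ^ p + y ^ p + of_nat p * r"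
proof -
  define r where "r = (\<Sum>k\<in>{0<..<p}. of_int (int ((p choose k) div p)) * (x ^ k * y ^ (p - k)))"
  have "p > 0"
    using \<open>prime p\<close> by (rule prime_gt_0_nat)
  then have set: "{..p} = insert 0 (insert p {0<..<p})"
    by auto
  have choose: "of_nat (p choose k) = (of_nat p * of_int (int ((p choose k) div p)) :: complex)"
    if "k \<in> {0<..<p}" for k
  proof -
    have "p dvd p choose k"
      using that \<open>prime p\<close> by (intro dvd_choose_prime) auto
    then have "p choose k = p * ((p choose k) div p)"
      by simp
    then show ?thesis
      by (metis of_int_of_nat_eq of_nat_mult)
  qed
  have "(x + y) ^ p = (\<Sum>k\<le>p. of_nat (p choose k) * x ^ k * y ^ (p - k))"
    by (rule binomial_ring)
  also have "\<dots> = x ^ p + y ^ p + (\<Sum>k\<in>{0<..<p}. of_nat (p choose k) * x ^ k * y ^ (p - k))"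
    unfolding set using \<open>p > 0\<close> by simp
  also have "(\<Sum>k\<in>{0<..<p}. of_nat (p choose k) * x ^ k * y ^ (p - k)) = of_nat p * r"
    unfolding r_def sum_distrib_left by (intro sum.cong refl) (simp add: choose)
  finally have "(x + y) ^ p = x ^ p + y ^ p + of_nat p * r" .
  moreover have "r \<in> int_span_powers m z"
    unfolding r_def by (intro int_span_powers_sum int_span_powers_scale mult_mem pow_mem x y)
  ultimately show ?thesis
    by blast
qed

end

section \<open>Sums of roots of unity modulo a prime\<close>

text \<open>By Frobenius the \<open>p\<close>-th power is additive modulo \<open>p\<close>, and each
  summand contributes \<open>(\<zeta> ^ p) ^ e i = 1\<close>.\<close>

lemma root_sum_power_prime:
  fixes p :: nat and \<zeta> :: complex and e :: "'i \<Rightarrow> nat"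
  assumes "prime p" "\<zeta> ^ p = 1" "finite A"
  shows "\<exists>r\<in>int_span_powers p \<zeta>. (\<Sum>i\<in>A. \<zeta> ^ e i) ^ p = of_nat (card A) + of_nat p * r"
proof -
  interpret root_of_unity p \<zeta>
    using assms by unfold_locales (auto simp: prime_gt_0_nat)
  show ?thesis
    using \<open>finite A\<close>
  proof (induction A rule: finite_induct)
    case empty
    show ?case
      using m_pos by (intro bexI[of _ 0] int_span_powers_zero) auto
  next
    case (insert i A)
    from insert.IH obtain r where r: "r \<in> int_span_powers p \<zeta>"
      "(\<Sum>i\<in>A. \<zeta> ^ e i) ^ p = of_nat (card A) + of_nat p * r"
      by blast
    from frobenius_add[OF \<open>prime p\<close> power_mem[of "e i"] int_span_powers_sum[of A "\<lambda>i. \<zeta> ^ e i", OF power_mem]]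
    obtain r' where r': "r' \<in> int_span_powers p \<zeta>"
      "(\<zeta> ^ e i + (\<Sum>i\<in>A. \<zeta> ^ e i)) ^ p = (\<zeta> ^ e i) ^ p + (\<Sum>i\<in>A. \<zeta> ^ e i) ^ p + of_nat p * r'"
      by blast
    have "(\<zeta> ^ e i) ^ p = 1"
      by (metis root power_mult mult.commute power_one)
    then show ?case
      using insert.hyps r r' by (intro bexI[of _ "r + r'"] int_span_powers_add) (auto simp: algebra_simps)
  qed
qed

lemma root_sums_eq_imp_card_cong:
  fixes p :: nat and \<zeta> :: complex and e :: "'i \<Rightarrow> nat" and f :: "'j \<Rightarrow> nat"
  assumes p: "prime p" "\<zeta> ^ p = 1" and fin: "finite A" "finite B"
    and eq: "(\<Sum>i\<in>A. \<zeta> ^ e i) = (\<Sum>j\<in>B. \<zeta> ^ f j)"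
  shows "int p dvd int (card A) - int (card B)"
proof -
  interpret root_of_unity p \<zeta>
    using p by unfold_locales (auto simp: prime_gt_0_nat)
  obtain r where r: "r \<in> int_span_powers p \<zeta>"
    "(\<Sum>i\<in>A. \<zeta> ^ e i) ^ p = of_nat (card A) + of_nat p * r"
    using root_sum_power_prime[OF p fin(1)] by blast
  obtain r' where r': "r' \<in> int_span_powers p \<zeta>"
    "(\<Sum>j\<in>B. \<zeta> ^ f j) ^ p = of_nat (card B) + of_nat p * r'"
    using root_sum_power_prime[OF p fin(2)] by blast
  have "of_int (int (card A) - int (card B)) = of_nat p * (r' - r)"
    using r(2) r'(2) eq by (simp add: algebra_simps)
  then show ?thesis
    using prime_dvd_of_mem[OF p(1) int_span_powers_diff[OF r'(1) r(1)]] by blast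
qed

section \<open>Periodic sequences and their autocorrelation\<close>

lemma sum_shift_period:
  fixes f :: "nat \<Rightarrow> 'a :: ab_group_add"
  assumes per: "\<And>i. f (i + N) = f i"
  shows "(\<Sum>i<N. f (i + c)) = (\<Sum>i<N. f i)"
proof (induction c)
  case (Suc c)
  have "(\<Sum>i<N. f (i + Suc c)) + f c = (\<Sum>i<Suc N. f (i + c))"
    by (subst sum.lessThan_Suc_shift) (simp add: add.commute)
  also have "\<dots> = (\<Sum>i<N. f (i + c)) + f c"
    using per[of c] by (simp add: add.commute)
  finally show ?case
    using Suc by simp
qed simp

lemma periodic_mod:
  fixes f :: "nat \<Rightarrow> 'a"
  assumes per: "\<And>i. f (i + N) = f i"
  shows "f (i mod N) = f i"
proof -
  have "f (j + N * q) = f j" for j q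
  proof (induction q)
    case (Suc q)
    have "f (j + N * Suc q) = f ((j + N * q) + N)"
      by (simp add: algebra_simps)
    then show ?case
      using per Suc by simp
  qed simp
  from this[of "i mod N" "i div N"] show ?thesis
    by simp
qed

text \<open>The summation window may start at any \<open>c\<close>, so that the zeros can be moved
  to its end.\<close>

lemma autocorrelation_shift:
  assumes per: "\<And>i. a (i + N) = a i"
  shows "autocorrelation N a t = (\<Sum>i<N. a (i + c) * cnj (a (i + c + t)))"
proof -
  have "a (i + N + t) = a (i + t)" for i
    using per[of "i + t"] by (simp add: algebra_simps)
  then have "(\<Sum>i<N. a (i + c) * cnj (a (i + c + t))) = (\<Sum>i<N. a i * cnj (a (i + t)))"
    using sum_shift_period[of "\<lambda>i. a i * cnj (a (i + t))" N c] per by simp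
  then show ?thesis
    by (simp add: autocorrelation_def periodic_mod[of a, OF per])
qed

text \<open>With the zeros at positions \<open>n\<close> to \<open>n + s - 1\<close> of the window,
  a product is nonzero when \<open>i\<close> and \<open>i + t\<close> are below \<open>n\<close>.
  For \<open>t \<le> s\<close> and \<open>i < n\<close>, \<open>i + t\<close> stays below
  \<open>n + s\<close>, so no nonzero entry of the next period is met.\<close>

lemma autocorrelation_root_sum:
  assumes m: "m > 0" "\<zeta> ^ m = 1"
    and alm: "almost_pary \<zeta> (n + s) s a" and cons: "consecutive_zeros s a"
  shows "\<exists>e. \<forall>t\<le>s. autocorrelation (n + s) a t = (\<Sum>i<n - t. \<zeta> ^ e t i)"
proof -
  interpret root_of_unity m \<zeta>
    using m by unfold_locales
  let ?N = "n + s"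
  have per: "a (i + ?N) = a i" for i
    using alm by (auto simp: almost_pary_def)
  have "?N > 0"
    using alm by (auto simp: almost_pary_def)
  obtain k where k: "\<And>j. j < s \<Longrightarrow> a (k + j) = 0"
    using cons by (auto simp: consecutive_zeros_def)
  \<comment> \<open>First position after the run of zeros; the run then recurs as the last
    \<open>s\<close> positions of the window from \<open>c\<close>.\<close>
  define c where "c = k + s"
  have zero: "a (i + c) = 0" if "n \<le> i" "i < ?N" for i
  proof -
    have "i + c = k + (i - n) + ?N"
      using that by (simp add: c_def)
    then show ?thesis
      using k[of "i - n"] that per[of "k + (i - n)"] by (metis less_diff_conv2 add.commute)
  qed
  have card_zeros: "card {i. i < ?N \<and> a (i + c) = 0} = s"
  proof -
    \<comment> \<open>Cardinalities become sums of indicators so that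
      \<open>sum_shift_period\<close> applies.\<close>
    have ind: "int (card {i. i < ?N \<and> P i}) = (\<Sum>i<?N. of_bool (P i))" for P
      by (simp add: Int_def)
    have "int (card {i. i < ?N \<and> a (i + c) = 0}) = int (card {i. i < ?N \<and> a i = 0})"
      unfolding ind using sum_shift_period[of "\<lambda>i. of_bool (a i = 0) :: int" ?N c] per by simp
    then show ?thesis
      using alm by (simp add: almost_pary_def)
  qed
  have "{n..<?N} = {i. i < ?N \<and> a (i + c) = 0}"
    using zero card_zeros by (intro card_subset_eq) auto
  then have "i \<in> {n..<?N} \<longleftrightarrow> i < ?N \<and> a (i + c) = 0" for i
    by blast
  then have nonzero: "a (i + c) \<noteq> 0" if "i < n" for i
    using that by (metis atLeastLessThan_iff not_less trans_less_add1)
  have powi: "\<exists>b. a (i + c) = \<zeta> powi b" if "i < n" for i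
  proof -
    have "a ((i + c) mod ?N) = a (i + c)"
      by (rule periodic_mod[of a, OF per])
    moreover have "(i + c) mod ?N < ?N"
      using \<open>?N > 0\<close> by simp
    ultimately show ?thesis
      using alm nonzero[OF that] unfolding almost_pary_def by metis
  qed
  have product: "\<exists>e. a (i + c) * cnj (a (i + t + c)) = \<zeta> ^ e" if it: "i < n - t" for i t
  proof -
    have "i < n" "i + t < n"
      using it by linarith+
    then obtain b b' where b: "a (i + c) = \<zeta> powi b" and b': "a (i + t + c) = \<zeta> powi b'"
      using powi by blast
    have "\<zeta> \<noteq> 0"
      using norm_root by auto
    then have "a (i + c) * cnj (a (i + t + c)) = \<zeta> powi (b + - b')"
      unfolding b b' cnj_powi by (simp only: power_int_add simp_thms)
    then show ?thesis
      using powi_eq_power by metis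
  qed
  \<comment> \<open>The choice is meaningful for \<open>i < n - t\<close>, the range of the final
    sum.\<close>
  define e where "e t i = (SOME e. a (i + c) * cnj (a (i + t + c)) = \<zeta> ^ e)" for t i
  have e: "a (i + c) * cnj (a (i + t + c)) = \<zeta> ^ e t i" if "i < n - t" for t i
    unfolding e_def by (rule someI_ex) (rule product[OF that])
  have "autocorrelation ?N a t = (\<Sum>i<n - t. \<zeta> ^ e t i)" if "t \<le> s" for t
  proof -
    have "autocorrelation ?N a t = (\<Sum>i<?N. a (i + c) * cnj (a (i + t + c)))"
      using autocorrelation_shift[of a ?N t c, OF per] by (simp add: ac_simps)
    also have "\<dots> = (\<Sum>i<n - t. a (i + c) * cnj (a (i + t + c)))"
    proof (rule sum.mono_neutral_right)
      show "\<forall>i\<in>{..<?N} - {..<n - t}. a (i + c) * cnj (a (i + t + c)) = 0"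
      proof
        fix i assume i: "i \<in> {..<?N} - {..<n - t}"
        show "a (i + c) * cnj (a (i + t + c)) = 0"
        proof (cases "i < n")
          case True
          then show ?thesis
            using zero[of "i + t"] i that by simp
        next
          case False
          then show ?thesis
            using zero[of i] i by simp
        qed
      qed
    qed auto
    also have "\<dots> = (\<Sum>i<n - t. \<zeta> ^ e t i)"
      by (intro sum.cong refl) (simp add: e)
    finally show ?thesis .
  qed
  then show ?thesis
    by blast
qed

section \<open>Counting autocorrelation values\<close>

theorem theorem3p1:
  fixes p n s l :: nat and \<zeta> :: complex and a :: "nat \<Rightarrow> complex"
  assumes "prime p"
    and "primitive_root_of_unity p \<zeta>"
    and "n > 0"
    and "almost_pary \<zeta> (n + s) s a"
    and "consecutive_zeros s a"
    and "l = card (autocorrelation (n + s) a ` {1..n + s - 1})"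
  shows "min s (min p n) \<le> l \<and> l \<le> n - 1 + min n s"
proof
  let ?C = "autocorrelation (n + s) a"
  have root: "p > 0" "\<zeta> ^ p = 1"
    using assms(2) by (auto simp: primitive_root_of_unity_def)
  obtain e where e: "\<And>t. t \<le> s \<Longrightarrow> ?C t = (\<Sum>i<n - t. \<zeta> ^ e t i)"
    using autocorrelation_root_sum[OF root assms(4,5)] by blast
  \<comment> \<open>\<open>m \<le> s\<close> makes the formula \<open>e\<close> available,
    \<open>m \<le> n\<close> makes \<open>n - t\<close> an exact difference, and
    \<open>m \<le> p\<close> forces \<open>\<bar>u - t\<bar> < p\<close>.\<close>
  define m where "m = min s (min p n)"
  have "inj_on ?C {1..m}"
  proof (rule inj_onI)
    fix t u assume t: "t \<in> {1..m}" and u: "u \<in> {1..m}" and "?C t = ?C u"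
    then have "(\<Sum>i<n - t. \<zeta> ^ e t i) = (\<Sum>i<n - u. \<zeta> ^ e u i)"
      using e by (simp add: m_def)
    from root_sums_eq_imp_card_cong[OF assms(1) root(2) finite_lessThan finite_lessThan this]
    have "int p dvd int (n - t) - int (n - u)"
      by simp
    moreover have "t \<le> n" "u \<le> n"
      using t u unfolding m_def by simp_all
    ultimately have "int p dvd int u - int t"
      by (simp add: of_nat_diff)
    moreover have "\<bar>int u - int t\<bar> < int p"
      using t u by (auto simp: m_def)
    ultimately have "int u - int t = 0"
      using dvd_imp_le_int[of "int u - int t" "int p"] by linarith
    then show "t = u"
      by simp
  qed
  then have "m = card (?C ` {1..m})"
    by (simp add: card_image)
  also have "\<dots> \<le> l"
    unfolding assms(6) by (intro card_mono image_mono) (use assms(3) in \<open>auto simp: m_def\<close>)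
  finally show "min s (min p n) \<le> l"
    unfolding m_def .
  show "l \<le> n - 1 + min n s"
  \<comment> \<open>If \<open>s \<le> n\<close>, the bound is just the number of shifts.\<close>
  proof (cases "s \<le> n")
    case True
    have "l \<le> card {1..n + s - 1}"
      unfolding assms(6) by (intro card_image_le) simp
    then show ?thesis
      using True assms(3) by simp
  next
    case False
    \<comment> \<open>The shifts from \<open>n\<close> to \<open>s\<close> give empty sums, hence
      the single value \<open>0\<close>; the other \<open>2 * (n - 1)\<close> shifts lie in
      \<open>?T\<close>.\<close>
    let ?T = "{1..n - 1} \<union> {s + 1..n + s - 1}"
    have "?C ` {1..n + s - 1} \<subseteq> insert 0 (?C ` ?T)"
    proof
      fix y assume "y \<in> ?C ` {1..n + s - 1}"
      then obtain t where t: "t \<in> {1..n + s - 1}" "y = ?C t"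
        by blast
      show "y \<in> insert 0 (?C ` ?T)"
      proof (cases "n \<le> t \<and> t \<le> s")
        case True
        then show ?thesis
          using e[of t] t(2) by simp
      next
        case False
        then have "t \<in> ?T"
          using t(1) by auto
        then show ?thesis
          using t(2) by blast
      qed
    qed
    then have "l \<le> card (insert 0 (?C ` ?T))"
      unfolding assms(6) by (intro card_mono) auto
    also have "\<dots> \<le> Suc (card (?C ` ?T))"
      by (rule card_insert_le_m1) auto
    also have "card (?C ` ?T) \<le> card ?T"
      by (rule card_image_le) simp
    also have "card ?T \<le> (n - 1) + (n - 1)"
      by (rule order_trans[OF card_Un_le]) simp
    finally show ?thesis
      using False assms(3) by simp
  qed
qed

end
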